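(* Let $1\le p,q\le\infty$ with $\frac1p+\frac1q=1$. (i) Let $h:\mathbb{R}^d\to\mathbb{R}$ be an $l$-layer ReLU neural network with $W_i$ as the weights for layer $i$ (bias terms are ignored), $$h(x)=\sigma(W_l\,\sigma(W_{l-1}\cdots\sigma(W_1x))),$$ and let $S\subset\mathbb{R}^d$ be a convex bounded closed set. Then $|h(x)-h(y)|\le L_q\|x-y\|_p$ holds for any $x,y\in S$ with $$L_q=\sup_{x\in S}\Big\{\Big|\sup_{\|v\|_p=1}D^+h(x;v)\Big|\Big\}.$$ (ii) Consequently, with Lipschitz constants given in this way by one-sided directional derivatives instead of maximum gradient norms, the following guarantees still hold for a multi-class classifier $f=(f_1,\dots,f_K):\mathbb{R}^d\to\mathbb{R}^K$ that is a ReLU neural network (instead of one with continuously differentiable components), where $x_0\in\mathbb{R}^d$ and $c=\operatorname{argmax}_{1\le i\le K}f_i(x_0)$: (a) if $L_q^j$ is the Lipschitz constant of $f_c-f_j$ in $\ell_p$ norm, then for all $\delta\in\mathbb{R}^d$ with $\|\delta\|_p\le\min_{j\ne c}\frac{f_c(x_0)-f_j(x_0)}{L_q^j}$ one has $\operatorname{argmax}_{1\le i\le K}f_i(x_0+\delta)=c$; that is, $\min_{j\ne c}\frac{f_c(x_0)-f_j(x_0)}{L_q^j}$ is a lower bound of the minimum $\ell_p$ adversarial distortion of $x_0$; (b) if $L_{q,x_0}^j$ is the local Lipschitz constant of $f_c-f_j$ at $x_0$ over some fixed ball $B_p(x_0,R)$ and $\delta\in B_p(0,R)$, then the guarantee $\operatorname{argmax}_{1\le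 i\le K}f_i(x_0+\delta)=c$ holds under the bound $\|\delta\|_p\le\min\big\{\min_{j\ne c}\frac{f_c(x_0)-f_j(x_0)}{L_{q,x_0}^j},R\big\}$; (c) for a specified target class $j\ne c$, the corresponding guarantee for targeted attacks holds under the bound $\|\delta\|_p\le\min\big\{\frac{f_c(x_0)-f_j(x_0)}{L_{q,x_0}^j},R\big\}$: such a $\delta$ does not give a successful targeted attack with target class $j$.
   Context: $\sigma(u)=\max(0,u)$, applied entrywise. The one-sided directional derivative of a function $h:\mathbb{R}^d\to\mathbb{R}$ at $x$ in direction $v$ is $D^+h(x;v):=\lim_{t\to0^+}\frac{h(x+tv)-h(x)}{t}$. $B_p(x_0,R)=\{x\in\mathbb{R}^d:\|x-x_0\|_p\le R\}$. The prediction at $x$ is $\operatorname{argmax}_{1\le i\le K}f_i(x)$. An adversarial example of $x_0$ is a point $x_0+\delta$ whose prediction differs from that of $x_0$; its $\ell_p$-distortion is $\|\delta\|_p$, and the minimum adversarial distortion is the smallest $\ell_p$-distortion over all adversarial examples of $x_0$. A lower bound of it is a number not exceeding it such that no $x_0+\delta$ with $\|\delta\|_p$ at most this number is an adversarial example. A targeted attack with target class $j\ne c$ is successful if the prediction at $x_0+\delta$ is $j$.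
   Formalization: At equality in the bounds another component may tie with f_c, so argmax = c can fail; the non-strict guarantees assume that ties are resolved in favour of c, and the strict-inequality versions are proved for any choice of maximiser. *)

theory Defs
  imports "HOL-Analysis.Analysis" "Jordan_Normal_Form.Matrix"
begin

no_notation vec_nth (infixl "$" 90)

definition lp_norm :: "ereal \<Rightarrow> real ^ 'd \<Rightarrow> real" where
  "lp_norm p x = (if p = \<infinity> then infnorm x
     else (\<Sum>i\<in>UNIV. \<bar>vec_nth x i\<bar> powr real_of_ereal p) powr (1 / real_of_ereal p))"

definition lp_ball :: "ereal \<Rightarrow> real ^ 'd \<Rightarrow> real \<Rightarrow> (real ^ 'd) set" where
  "lp_ball p x0 R = {x. lp_norm p (x - x0) \<le> R}"

definition dir_deriv :: "(real ^ 'd \<Rightarrow> real) \<Rightarrow> real ^ 'd \<Rightarrow> real ^ 'd \<Rightarrow> real" where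
  "dir_deriv h x v = Lim (at_right 0) (\<lambda>t. (h (x + t *\<^sub>R v) - h x) / t)"

text \<open>The constant usually written $L_q$ (with $q$ the exponent conjugate to $p$): for a
  differentiable function the inner supremum is the $q$-norm of the gradient.\<close>

definition dir_lip :: "ereal \<Rightarrow> (real ^ 'd \<Rightarrow> real) \<Rightarrow> (real ^ 'd) set \<Rightarrow> real" where
  "dir_lip p h S = (SUP x\<in>S. \<bar>SUP v\<in>{v. lp_norm p v = 1}. dir_deriv h x v\<bar>)"

text \<open>The widths of the hidden layers are arbitrary, so layers are matrices with explicit
  dimensions; the list of weights is \<open>[W\<^sub>1, \<dots>, W\<^sub>l]\<close>, the first layer being applied first.
  The input is turned into such a vector by a fixed enumeration of its coordinates; which
  enumeration is irrelevant, since the weights are arbitrary.\<close>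

definition input_vec :: "real ^ 'd \<Rightarrow> real vec" where
  "input_vec x = Matrix.vec CARD('d) (\<lambda>i. vec_nth x (from_nat_into UNIV i))"

definition relu :: "real \<Rightarrow> real" where
  "relu u = max 0 u"

primrec relu_layers :: "real mat list \<Rightarrow> real vec \<Rightarrow> real vec" where
  "relu_layers [] z = z"
| "relu_layers (W # Ws) z = relu_layers Ws (map_vec relu (W *\<^sub>v z))"

primrec layer_dims :: "nat \<Rightarrow> real mat list \<Rightarrow> nat \<Rightarrow> bool" where
  "layer_dims m [] n \<longleftrightarrow> m = n"
| "layer_dims m (W # Ws) n \<longleftrightarrow> dim_col W = m \<and> layer_dims (dim_row W) Ws n"

definition relu_net :: "real mat list \<Rightarrow> real ^ 'd \<Rightarrow> real vec" where
  "relu_net Ws x = relu_layers Ws (input_vec x)"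

definition is_relu_function :: "nat \<Rightarrow> (real ^ 'd \<Rightarrow> real) \<Rightarrow> bool" where
  "is_relu_function l h \<longleftrightarrow>
     (\<exists>Ws. length Ws = l \<and> l \<ge> 1 \<and> layer_dims CARD('d) Ws 1 \<and> h = (\<lambda>x. relu_net Ws x $ 0))"

text \<open>Classes are numbered \<open>0, \<dots>, K - 1\<close>. Both customary forms of a classifier network are
  admitted: with the activation on the output layer, and with a linear output layer.\<close>

definition is_relu_classifier :: "nat \<Rightarrow> (real ^ 'd \<Rightarrow> real vec) \<Rightarrow> bool" where
  "is_relu_classifier K f \<longleftrightarrow>
     (\<exists>Ws. Ws \<noteq> [] \<and> layer_dims CARD('d) Ws K \<and>
        (f = relu_net Ws \<or> f = (\<lambda>x. last Ws *\<^sub>v relu_net (butlast Ws) x)))"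

text \<open>A prediction rule selects a class attaining the maximum; the selection is only ambiguous at
  points where several components tie for it.\<close>

definition prediction_rule :: "nat \<Rightarrow> (real ^ 'd \<Rightarrow> real vec) \<Rightarrow> (real ^ 'd \<Rightarrow> nat) \<Rightarrow> bool" where
  "prediction_rule K f pred \<longleftrightarrow> (\<forall>x. is_arg_max (\<lambda>i. f x $ i) (\<lambda>i. i < K) (pred x))"

text \<open>At distance exactly equal to the bounds considered, another component can tie with that
  of \<open>c\<close>, so that guarantees under a non-strict bound need ties to be resolved in favour of \<open>c\<close>.\<close>

definition ties_to :: "nat \<Rightarrow> nat \<Rightarrow> (real ^ 'd \<Rightarrow> real vec) \<Rightarrow> (real ^ 'd \<Rightarrow> nat) \<Rightarrow> bool" where
  "ties_to c K f pred \<longleftrightarrow> (\<forall>x. is_arg_max (\<lambda>i. f x $ i) (\<lambda>i. i < K) c \<longrightarrow> pred x = c)"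

definition adversarial :: "(real ^ 'd \<Rightarrow> nat) \<Rightarrow> real ^ 'd \<Rightarrow> real ^ 'd \<Rightarrow> bool" where
  "adversarial pred x0 \<delta> \<longleftrightarrow> pred (x0 + \<delta>) \<noteq> pred x0"

text \<open>An infimum, as the smallest distortion need not be attained; it is \<open>\<infinity>\<close> if there is no
  adversarial example.\<close>

definition min_distortion :: "ereal \<Rightarrow> (real ^ 'd \<Rightarrow> nat) \<Rightarrow> real ^ 'd \<Rightarrow> ereal" where
  "min_distortion p pred x0 = (INF \<delta>\<in>{\<delta>. adversarial pred x0 \<delta>}. ereal (lp_norm p \<delta>))"

definition distortion_lower_bound ::
    "ereal \<Rightarrow> (real ^ 'd \<Rightarrow> nat) \<Rightarrow> real ^ 'd \<Rightarrow> ereal \<Rightarrow> bool" where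
  "distortion_lower_bound p pred x0 b \<longleftrightarrow>
     b \<le> min_distortion p pred x0 \<and> (\<forall>\<delta>. ereal (lp_norm p \<delta>) \<le> b \<longrightarrow> \<not> adversarial pred x0 \<delta>)"

definition successful_targeted :: "(real ^ 'd \<Rightarrow> nat) \<Rightarrow> nat \<Rightarrow> real ^ 'd \<Rightarrow> real ^ 'd \<Rightarrow> bool" where
  "successful_targeted pred j x0 \<delta> \<longleftrightarrow> pred (x0 + \<delta>) = j"

definition margin :: "(real ^ 'd \<Rightarrow> real vec) \<Rightarrow> nat \<Rightarrow> nat \<Rightarrow> real ^ 'd \<Rightarrow> real" where
  "margin f c j x = f x $ c - f x $ j"

text \<open>The division is in the extended reals: a positive margin over the Lipschitz constant \<open>0\<close>
  gives \<open>\<infinity>\<close> (and \<open>0 / 0 = 0\<close>). Likewise the minimum over no class at all is \<open>\<infinity>\<close>.\<close>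

definition class_bound ::
    "ereal \<Rightarrow> (real ^ 'd \<Rightarrow> real vec) \<Rightarrow> nat \<Rightarrow> real ^ 'd \<Rightarrow> (real ^ 'd) set \<Rightarrow> nat \<Rightarrow> ereal" where
  "class_bound p f c x0 S j = ereal (margin f c j x0) / ereal (dir_lip p (margin f c j) S)"

definition min_class_bound ::
    "ereal \<Rightarrow> nat \<Rightarrow> (real ^ 'd \<Rightarrow> real vec) \<Rightarrow> nat \<Rightarrow> real ^ 'd \<Rightarrow> (real ^ 'd) set \<Rightarrow> ereal" where
  "min_class_bound p K f c x0 S = (INF j\<in>{..<K} - {c}. class_bound p f c x0 S j)"

end

theory Submission
  imports Defs
begin

text \<open>Along every ray a ReLU network is affine near the starting point, so on the segment from
  \<open>x\<close> to \<open>y\<close> the right derivative of \<open>h\<close> exists everywhere and is at most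
  \<open>dir_lip p h S * lp_norm p (y - x)\<close>; a continuous function whose right derivative is bounded above
  grows no faster than this bound. Only upper bounds on derivatives are needed, since the two
  orientations of the segment give the two signs of \<open>h x - h y\<close>. The guarantees for a classifier
  follow by applying this to the margins on the segment from \<open>x0\<close> to \<open>x0 + \<delta>\<close>.\<close>

section \<open>Functions that are locally affine along rays\<close>

text \<open>The slope \<open>a\<close> and the range of \<open>t\<close> may depend on
  \<open>x\<close> and \<open>v\<close>; this class contains the linear maps and is closed under
  \<open>relu\<close>. The global Lipschitz constant supplies continuity and a uniform bound on all
  slopes.\<close>

definition ray_affine :: "('a::real_normed_vector \<Rightarrow> real) \<Rightarrow> bool" where
  "ray_affine h \<longleftrightarrow> (\<exists>C. C-lipschitz_on UNIV h) \<and>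
     (\<forall>x v. \<exists>a. \<forall>\<^sub>F t in at_right 0. h (x + t *\<^sub>R v) = h x + t * a)"

lemma ray_affine_lipschitz:
  assumes "ray_affine h"
  obtains C where "C-lipschitz_on UNIV h"
  using assms unfolding ray_affine_def by blast

lemma ray_affine_slope:
  assumes "ray_affine h"
  obtains a where "\<forall>\<^sub>F t in at_right 0. h (x + t *\<^sub>R v) = h x + t * a"
  using assms unfolding ray_affine_def by blast

section \<open>Closure properties\<close>

lemma ray_affine_const: "ray_affine (\<lambda>x. c)"
  unfolding ray_affine_def
proof (intro conjI allI)
  show "\<exists>C. C-lipschitz_on UNIV (\<lambda>x. c)"
    by (intro exI[of _ 0] lipschitz_onI) auto
  show "\<exists>a. \<forall>\<^sub>F t in at_right 0. c = c + t * a"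
    by (intro exI[of _ 0]) simp
qed

lemma ray_affine_bounded_linear:
  assumes "bounded_linear h"
  shows "ray_affine h"
  unfolding ray_affine_def
proof (intro conjI allI)
  interpret bounded_linear h by fact
  obtain B where "B-lipschitz_on UNIV h" by (rule lipschitz_boundE)
  then show "\<exists>C. C-lipschitz_on UNIV h" ..
  fix x v
  show "\<exists>a. \<forall>\<^sub>F t in at_right 0. h (x + t *\<^sub>R v) = h x + t * a"
    by (intro exI[of _ "h v"]) (simp add: add scaleR)
qed

lemma ray_affine_add:
  assumes "ray_affine g" "ray_affine h"
  shows "ray_affine (\<lambda>x. g x + h x)"
  unfolding ray_affine_def
proof (intro conjI allI)
  obtain C D where "C-lipschitz_on UNIV g" "D-lipschitz_on UNIV h"
    using assms by (meson ray_affine_lipschitz)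
  then have "(C + D)-lipschitz_on UNIV (\<lambda>x. g x + h x)"
    by (rule lipschitz_on_add)
  then show "\<exists>C. C-lipschitz_on UNIV (\<lambda>x. g x + h x)" ..
  fix x v
  obtain a where "\<forall>\<^sub>F t in at_right 0. g (x + t *\<^sub>R v) = g x + t * a"
    using assms(1) by (rule ray_affine_slope)
  moreover obtain b where "\<forall>\<^sub>F t in at_right 0. h (x + t *\<^sub>R v) = h x + t * b"
    using assms(2) by (rule ray_affine_slope)
  ultimately have "\<forall>\<^sub>F t in at_right 0. g (x + t *\<^sub>R v) + h (x + t *\<^sub>R v) = g x + h x + t * (a + b)"
    by eventually_elim (simp add: algebra_simps)
  then show "\<exists>a. \<forall>\<^sub>F t in at_right 0. g (x + t *\<^sub>R v) + h (x + t *\<^sub>R v) = g x + h x + t * a" ..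
qed

lemma ray_affine_cmult:
  assumes "ray_affine h"
  shows "ray_affine (\<lambda>x. c * h x)"
  unfolding ray_affine_def
proof (intro conjI allI)
  obtain C where "C-lipschitz_on UNIV h"
    using assms by (rule ray_affine_lipschitz)
  then have "(\<bar>c\<bar> * C)-lipschitz_on UNIV (\<lambda>x. c * h x)"
    by (rule lipschitz_on_cmult_real)
  then show "\<exists>C. C-lipschitz_on UNIV (\<lambda>x. c * h x)" ..
  fix x v
  obtain a where "\<forall>\<^sub>F t in at_right 0. h (x + t *\<^sub>R v) = h x + t * a"
    using assms by (rule ray_affine_slope)
  then have "\<forall>\<^sub>F t in at_right 0. c * h (x + t *\<^sub>R v) = c * h x + t * (c * a)"
    by eventually_elim (simp add: algebra_simps)
  then show "\<exists>a. \<forall>\<^sub>F t in at_right 0. c * h (x + t *\<^sub>R v) = c * h x + t * a" ..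
qed

lemma ray_affine_diff:
  assumes "ray_affine g" "ray_affine h"
  shows "ray_affine (\<lambda>x. g x - h x)"
  using ray_affine_add[OF assms(1) ray_affine_cmult[OF assms(2), of "-1"]] by simp

lemma ray_affine_sum:
  assumes "\<And>i. i \<in> I \<Longrightarrow> ray_affine (h i)"
  shows "ray_affine (\<lambda>x. \<Sum>i\<in>I. h i x)"
  using assms
proof (induction I rule: infinite_finite_induct)
  case (insert i I)
  then have "ray_affine (\<lambda>x. h i x + (\<Sum>i\<in>I. h i x))"
    by (intro ray_affine_add) simp_all
  with insert.hyps show ?case by simp
qed (simp_all add: ray_affine_const)

text \<open>A nonzero sign of \<open>h x\<close> persists for small \<open>t\<close>, so the slope
  becomes \<open>0\<close> or stays \<open>a\<close>. Where \<open>h x = 0\<close>, positivity of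
  \<open>t\<close> gives \<open>relu (t * a) = t * relu a\<close>; this is why slopes are
  one-sided.\<close>

lemma ray_affine_relu:
  assumes "ray_affine h"
  shows "ray_affine (\<lambda>x. relu (h x))"
  unfolding ray_affine_def
proof (intro conjI allI)
  obtain C where C: "C-lipschitz_on UNIV h"
    using assms by (rule ray_affine_lipschitz)
  have "C-lipschitz_on UNIV (\<lambda>x. relu (h x))"
  proof (rule lipschitz_onI)
    fix x y
    have "dist (relu (h x)) (relu (h y)) \<le> dist (h x) (h y)"
      by (auto simp: relu_def dist_real_def)
    also have "\<dots> \<le> C * dist x y"
      using C by (simp add: lipschitz_onD)
    finally show "dist (relu (h x)) (relu (h y)) \<le> C * dist x y" .
  qed (rule lipschitz_on_nonneg[OF C])
  then show "\<exists>C. C-lipschitz_on UNIV (\<lambda>x. relu (h x))" ..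
  fix x v
  obtain a where a: "\<forall>\<^sub>F t in at_right 0. h (x + t *\<^sub>R v) = h x + t * a"
    using assms by (rule ray_affine_slope)
  have lim: "((\<lambda>t. h x + t * a) \<longlongrightarrow> h x) (at_right 0)"
    by (auto intro!: tendsto_eq_intros)
  show "\<exists>b. \<forall>\<^sub>F t in at_right 0. relu (h (x + t *\<^sub>R v)) = relu (h x) + t * b"
  proof (rule linorder_cases[of "h x" 0])
    assume neg: "h x < 0"
    have "\<forall>\<^sub>F t in at_right 0. relu (h (x + t *\<^sub>R v)) = relu (h x) + t * 0"
      using a order_tendstoD(2)[OF lim neg]
      by eventually_elim (use neg in \<open>auto simp: relu_def\<close>)
    then show ?thesis ..
  next
    assume pos: "h x > 0"
    have "\<forall>\<^sub>F t in at_right 0. relu (h (x + t *\<^sub>R v)) = relu (h x) + t * a"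
      using a order_tendstoD(1)[OF lim pos]
      by eventually_elim (use pos in \<open>auto simp: relu_def\<close>)
    then show ?thesis ..
  next
    assume zero: "h x = 0"
    have "\<forall>\<^sub>F t in at_right 0. relu (h (x + t *\<^sub>R v)) = relu (h x) + t * relu a"
      using a eventually_at_right_less[of 0]
      by eventually_elim (use zero in \<open>auto simp: relu_def max_def zero_le_mult_iff\<close>)
    then show ?thesis ..
  qed
qed

section \<open>One-sided directional derivatives\<close>

lemma dir_deriv_eqI:
  assumes "\<forall>\<^sub>F t in at_right 0. h (x + t *\<^sub>R v) = h x + t * a"
  shows "dir_deriv h x v = a"
  unfolding dir_deriv_def
\<comment> \<open>The difference quotient is eventually constant, so \<open>Lim\<close> denotes a
  genuine limit.\<close>
proof (rule tendsto_Lim)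
  have "\<forall>\<^sub>F t in at_right 0. (h (x + t *\<^sub>R v) - h x) / t = a"
    using assms eventually_at_right_less[of 0] by eventually_elim simp
  then show "((\<lambda>t. (h (x + t *\<^sub>R v) - h x) / t) \<longlongrightarrow> a) (at_right 0)"
    by (rule tendsto_eventually)
qed simp

lemma ray_affine_dir_deriv:
  assumes "ray_affine h"
  shows "\<forall>\<^sub>F t in at_right 0. h (x + t *\<^sub>R v) = h x + t * dir_deriv h x v"
proof -
  obtain a where "\<forall>\<^sub>F t in at_right 0. h (x + t *\<^sub>R v) = h x + t * a"
    using assms by (rule ray_affine_slope)
  then show ?thesis
    by (simp add: dir_deriv_eqI)
qed

text \<open>A single \<open>t > 0\<close> at which the affine formula is exact turns the Lipschitz
  estimate into a bound on the slope.\<close>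

lemma abs_dir_deriv_le:
  assumes h: "ray_affine h" and C: "C-lipschitz_on UNIV h"
  shows "\<bar>dir_deriv h x v\<bar> \<le> C * norm v"
proof -
  have "\<forall>\<^sub>F t in at_right 0. h (x + t *\<^sub>R v) = h x + t * dir_deriv h x v \<and> 0 < t"
    using ray_affine_dir_deriv[OF h] eventually_at_right_less by (rule eventually_conj)
  from eventually_happens'[OF trivial_limit_at_right_real this]
  obtain t where t: "h (x + t *\<^sub>R v) = h x + t * dir_deriv h x v" "0 < t"
    by blast
  have "t * \<bar>dir_deriv h x v\<bar> \<le> t * (C * norm v)"
    using lipschitz_onD[OF C, of "x + t *\<^sub>R v" x] t
    by (simp add: dist_norm abs_mult mult.left_commute)
  then show ?thesis
    using t by simp
qed

lemma ray_affine_dir_deriv_scaleR: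
  assumes h: "ray_affine h" and c: "c > 0"
  shows "dir_deriv h x (c *\<^sub>R v) = c * dir_deriv h x v"
proof (rule dir_deriv_eqI)
  \<comment> \<open>Rescaling \<open>t\<close> by \<open>c > 0\<close> preserves the approach to
    \<open>0\<close> from the right.\<close>
  have "filterlim (\<lambda>t. c * t) (at_right 0) (at_right 0)"
    by (rule filterlim_times_pos[OF filterlim_ident c]) simp
  from eventually_compose_filterlim[OF ray_affine_dir_deriv[OF h] this, of x v]
  show "\<forall>\<^sub>F t in at_right 0. h (x + t *\<^sub>R c *\<^sub>R v) = h x + t * (c * dir_deriv h x v)"
    by (simp add: mult_ac)
qed

text \<open>The last point of the segment at which the claimed growth bound holds is its endpoint.\<close>

lemma ray_affine_increment_le:
  assumes h: "ray_affine h"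
    and B: "\<And>t. 0 \<le> t \<Longrightarrow> t < 1 \<Longrightarrow> dir_deriv h (x + t *\<^sub>R v) v \<le> B"
  shows "h (x + v) - h x \<le> B"
proof -
  \<comment> \<open>Subtracting the permitted growth turns the claim into
    \<open>g 1 \<le> g 0\<close>.\<close>
  define g where "g t = h (x + t *\<^sub>R v) - B * t" for t
  obtain C where "C-lipschitz_on UNIV h"
    using h by (rule ray_affine_lipschitz)
  then have "continuous_on UNIV h"
    by (rule lipschitz_on_continuous_on)
  then have "continuous_on {0..1} (\<lambda>t. h (x + t *\<^sub>R v))"
    by (rule continuous_on_compose2) (auto intro!: continuous_intros)
  then have g: "continuous_on {0..1} g"
    unfolding g_def by (intro continuous_intros)
  \<comment> \<open>By continuity the times satisfying the bound form a compact set, which has a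
    largest element \<open>s\<close>.\<close>
  define A where "A = {0..1} \<inter> g -` {..g 0}"
  have "closed A"
    unfolding A_def by (intro continuous_closed_preimage g) auto
  moreover have "bounded A"
    by (rule bounded_subset[of "{0..1}"]) (auto simp: A_def)
  ultimately have "compact A"
    by (simp add: compact_eq_bounded_closed)
  moreover have "0 \<in> A"
    by (simp add: A_def)
  ultimately obtain s where s: "s \<in> A" and s_max: "\<And>t. t \<in> A \<Longrightarrow> t \<le> s"
    using compact_attains_sup[of A] by blast
  have "s = 1"
  proof (rule ccontr)
    assume "s \<noteq> 1"
    with s have s01: "0 \<le> s" "s < 1" by (auto simp: A_def)
    have "\<forall>\<^sub>F t in at_right 0. t < 1 - s"
      using s01 by (intro order_tendstoD(2)[OF tendsto_ident_at]) auto
    then have "\<forall>\<^sub>F t in at_right 0.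
        h ((x + s *\<^sub>R v) + t *\<^sub>R v) = h (x + s *\<^sub>R v) + t * dir_deriv h (x + s *\<^sub>R v) v
        \<and> 0 < t \<and> t < 1 - s"
      by (intro eventually_conj ray_affine_dir_deriv[OF h] eventually_at_right_less)
    from eventually_happens'[OF trivial_limit_at_right_real this]
    obtain t where t: "0 < t" "t < 1 - s"
      "h ((x + s *\<^sub>R v) + t *\<^sub>R v) = h (x + s *\<^sub>R v) + t * dir_deriv h (x + s *\<^sub>R v) v"
      by blast
    \<comment> \<open>The slope at \<open>s\<close> is at most \<open>B\<close>, so the bound
      survives from \<open>s\<close> to \<open>s + t\<close>, against the maximality of
      \<open>s\<close>.\<close>
    have "t * dir_deriv h (x + s *\<^sub>R v) v \<le> t * B"
      using B[OF s01] t by (intro mult_left_mono) auto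
    then have "g (s + t) \<le> g s"
      using t(3) by (simp add: g_def algebra_simps)
    then have "s + t \<in> A"
      using s s01 t by (auto simp: A_def)
    then show False
      using s_max[of "s + t"] t by simp
  qed
  then show ?thesis
    using s by (simp add: A_def g_def)
qed

section \<open>The norms and the Lipschitz constant\<close>

lemma lp_norm_nonneg: "0 \<le> lp_norm p x"
  by (simp add: lp_norm_def infnorm_pos_le)

lemma lp_norm_scaleR:
  assumes "1 \<le> p"
  shows "lp_norm p (c *\<^sub>R x) = \<bar>c\<bar> * lp_norm p x"
proof (cases p)
  case (real r)
  with assms have r: "r \<ge> 1" by simp
  have "(\<Sum>i\<in>UNIV. \<bar>vec_nth (c *\<^sub>R x) i\<bar> powr r)
      = \<bar>c\<bar> powr r * (\<Sum>i\<in>UNIV. \<bar>vec_nth x i\<bar> powr r)"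
    by (simp add: abs_mult powr_mult sum_distrib_left)
  with r real show ?thesis
    by (simp add: lp_norm_def powr_mult sum_nonneg powr_powr)
qed (use assms in \<open>auto simp: lp_norm_def infnorm_mul\<close>)

lemma lp_norm_zero: "1 \<le> p \<Longrightarrow> lp_norm p 0 = 0"
  using lp_norm_scaleR[of p 0 0] by simp

lemma lp_norm_minus: "1 \<le> p \<Longrightarrow> lp_norm p (- x) = lp_norm p x"
  using lp_norm_scaleR[of p "-1" x] by simp

lemma component_le_lp_norm:
  assumes "1 \<le> p"
  shows "\<bar>vec_nth x i\<bar> \<le> lp_norm p x"
proof (cases p)
  case (real r)
  with assms have r: "r \<ge> 1" by simp
  have "\<bar>vec_nth x i\<bar> = (\<bar>vec_nth x i\<bar> powr r) powr (1 / r)"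
    using r by (simp add: powr_powr)
  also have "\<dots> \<le> (\<Sum>i\<in>UNIV. \<bar>vec_nth x i\<bar> powr r) powr (1 / r)"
    using r by (intro powr_mono2 member_le_sum) auto
  finally show ?thesis
    using real by (simp add: lp_norm_def)
qed (use assms in \<open>auto simp: lp_norm_def component_le_infnorm_cart\<close>)

lemma lp_norm_pos:
  assumes "1 \<le> p" "x \<noteq> 0"
  shows "0 < lp_norm p x"
proof -
  obtain i where "vec_nth x i \<noteq> 0"
    using assms(2) by (auto simp: Finite_Cartesian_Product.vec_eq_iff)
  then show ?thesis
    using component_le_lp_norm[OF assms(1), of x i] by linarith
qed

text \<open>A crude comparison through the sum of absolute values; it serves to turn Euclidean
  Lipschitz estimates into bounds on the \<open>lp_norm\<close> unit sphere.\<close>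

lemma norm_le_lp_norm:
  fixes x :: "real ^ 'd"
  assumes "1 \<le> p"
  shows "norm x \<le> CARD('d) * lp_norm p x"
proof -
  have "norm x \<le> (\<Sum>i\<in>UNIV. \<bar>vec_nth x i\<bar>)"
    by (rule norm_le_l1_cart)
  also have "\<dots> \<le> (\<Sum>i\<in>(UNIV :: 'd set). lp_norm p x)"
    by (intro sum_mono component_le_lp_norm assms)
  finally show ?thesis by simp
qed

section \<open>Finiteness of the suprema in \<open>dir_lip\<close>\<close>

lemma lp_sphere_nonempty:
  assumes "1 \<le> p"
  shows "{v :: real ^ 'd. lp_norm p v = 1} \<noteq> {}"
proof -
  \<comment> \<open>The witness is the normalised all-ones vector.\<close>
  have "lp_norm p ((1 / lp_norm p (1 :: real ^ 'd)) *\<^sub>R (1 :: real ^ 'd)) = 1"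
    using lp_norm_pos[OF assms, of "1 :: real ^ 'd"] by (auto simp: lp_norm_scaleR assms)
  then show ?thesis by blast
qed

text \<open>\<open>M\<close> is uniform in \<open>x\<close> because the Lipschitz constant is
  global, so the outer supremum is finite even for \<open>S = UNIV\<close>.\<close>

lemma dir_deriv_sphere_bounded:
  fixes h :: "real ^ 'd \<Rightarrow> real"
  assumes p: "1 \<le> p" and h: "ray_affine h"
  obtains M where "\<And>x v. lp_norm p v = 1 \<Longrightarrow> \<bar>dir_deriv h x v\<bar> \<le> M"
proof -
  obtain C where C: "C-lipschitz_on UNIV h"
    using h by (rule ray_affine_lipschitz)
  have "\<bar>dir_deriv h x v\<bar> \<le> C * CARD('d)" if "lp_norm p v = 1" for x v
  proof -
    have "\<bar>dir_deriv h x v\<bar> \<le> C * norm v"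
      by (rule abs_dir_deriv_le[OF h C])
    also have "\<dots> \<le> C * CARD('d)"
      using norm_le_lp_norm[OF p, of v] that
      by (intro mult_left_mono lipschitz_on_nonneg[OF C]) simp
    finally show ?thesis .
  qed
  then show thesis by (rule that)
qed

text \<open>The boundedness in these two lemmas is needed because an unbounded supremum of reals is a
  junk value.\<close>

lemma
  fixes h :: "real ^ 'd \<Rightarrow> real"
  assumes p: "1 \<le> p" and h: "ray_affine h"
  shows bdd_above_dir_deriv: "bdd_above (dir_deriv h x ` {v. lp_norm p v = 1})" (is ?th1)
    and bdd_above_sup_dir_deriv:
      "bdd_above ((\<lambda>x. \<bar>SUP v\<in>{v. lp_norm p v = 1}. dir_deriv h x v\<bar>) ` S)" (is ?th2)
proof -
  obtain M where M: "\<And>x v. lp_norm p v = 1 \<Longrightarrow> \<bar>dir_deriv h x v\<bar> \<le> M"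
    using dir_deriv_sphere_bounded[OF p h] by blast
  show ?th1
    using M by (intro bdd_aboveI2[of _ _ M]) (simp add: abs_le_iff)
  \<comment> \<open>A supremum over a nonempty set of numbers of modulus at most \<open>M\<close>
    again has modulus at most \<open>M\<close>.\<close>
  show ?th2
    using M lp_sphere_nonempty[OF p] by (intro bdd_aboveI2[of _ _ M] cSup_abs_le) auto
qed

text \<open>A point of \<open>S\<close> excludes the supremum over the empty set, whose value is
  unspecified.\<close>

lemma dir_lip_nonneg:
  assumes "1 \<le> p" "ray_affine h" "x \<in> S"
  shows "0 \<le> dir_lip p h S"
  unfolding dir_lip_def
  by (intro cSUP_upper2[OF _ assms(3) abs_ge_zero] bdd_above_sup_dir_deriv assms)

text \<open>The inner supremum ranges over unit directions, so \<open>v\<close> is normalised and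
  the estimate is scaled back by positive homogeneity.\<close>

lemma dir_deriv_le_dir_lip:
  assumes p: "1 \<le> p" and h: "ray_affine h" and "x \<in> S" and "v \<noteq> 0"
  shows "dir_deriv h x v \<le> dir_lip p h S * lp_norm p v"
proof -
  define w where "w = (1 / lp_norm p v) *\<^sub>R v"
  have v: "0 < lp_norm p v"
    by (rule lp_norm_pos) fact+
  then have "lp_norm p w = 1"
    by (simp add: w_def lp_norm_scaleR p)
  then have "dir_deriv h x w \<le> (SUP v\<in>{v. lp_norm p v = 1}. dir_deriv h x v)"
    by (intro cSUP_upper bdd_above_dir_deriv p h) simp
  also have "\<dots> \<le> \<bar>SUP v\<in>{v. lp_norm p v = 1}. dir_deriv h x v\<bar>"
    by simp
  also have "\<dots> \<le> dir_lip p h S"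
    unfolding dir_lip_def by (intro cSUP_upper \<open>x \<in> S\<close> bdd_above_sup_dir_deriv p h)
  finally have "lp_norm p v * dir_deriv h x w \<le> lp_norm p v * dir_lip p h S"
    using v by (intro mult_left_mono) auto
  moreover have "lp_norm p v *\<^sub>R w = v"
    using v by (simp add: w_def)
  ultimately show ?thesis
    using ray_affine_dir_deriv_scaleR[OF h v, of x w] by (simp add: mult.commute)
qed

section \<open>Growth along segments\<close>

lemma segment_increment_le:
  assumes p: "1 \<le> p" and h: "ray_affine h" and S: "closed_segment x y \<subseteq> S"
  shows "h y - h x \<le> dir_lip p h S * lp_norm p (x - y)"
proof (cases "x = y")
  \<comment> \<open>The degenerate segment is split off because bounding the slope normalises the
    direction \<open>y - x\<close>.\<close>
  case False
  have "h (x + (y - x)) - h x \<le> dir_lip p h S * lp_norm p (y - x)"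
  proof (rule ray_affine_increment_le[OF h])
    fix t :: real
    assume "0 \<le> t" "t < 1"
    then have "x + t *\<^sub>R (y - x) \<in> closed_segment x y"
      by (auto simp: in_segment algebra_simps intro!: exI[of _ t])
    with S have "x + t *\<^sub>R (y - x) \<in> S" by blast
    then show "dir_deriv h (x + t *\<^sub>R (y - x)) (y - x) \<le> dir_lip p h S * lp_norm p (y - x)"
      using False by (intro dir_deriv_le_dir_lip p h) auto
  qed
  then show ?thesis
    using lp_norm_minus[OF p, of "x - y"] by simp
qed (simp add: lp_norm_zero p)

text \<open>Asking only for the segment inside \<open>S\<close> lets this serve convex sets, balls
  around \<open>x0\<close> and the whole space alike.\<close>

lemma dir_lip_segment_bound:
  assumes p: "1 \<le> p" and h: "ray_affine h" and S: "closed_segment x y \<subseteq> S"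
  shows "\<bar>h x - h y\<bar> \<le> dir_lip p h S * lp_norm p (x - y)"
  using segment_increment_le[OF p h S] segment_increment_le[OF p h, of y x S] S
    lp_norm_minus[OF p, of "x - y"]
  by (simp add: closed_segment_commute abs_le_iff)

text \<open>A segment from the centre consists of the points
  \<open>x0 + u *\<^sub>R \<delta>\<close>, and homogeneity of the norm keeps these in the
  ball.\<close>

lemma closed_segment_lp_ball:
  assumes p: "1 \<le> p" and \<delta>: "\<delta> \<in> lp_ball p 0 R"
  shows "closed_segment x0 (x0 + \<delta>) \<subseteq> lp_ball p x0 R"
proof
  fix z
  assume "z \<in> closed_segment x0 (x0 + \<delta>)"
  then obtain u where u: "0 \<le> u" "u \<le> 1" "z = (1 - u) *\<^sub>R x0 + u *\<^sub>R (x0 + \<delta>)"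
    by (auto simp: in_segment)
  then have "lp_norm p (z - x0) = u * lp_norm p \<delta>"
    by (simp add: algebra_simps lp_norm_scaleR[OF p])
  also have "\<dots> \<le> lp_norm p \<delta>"
    using u lp_norm_nonneg by (intro mult_left_le_one_le) auto
  also have "\<dots> \<le> R"
    using \<delta> by (simp add: lp_ball_def)
  finally show "z \<in> lp_ball p x0 R"
    by (simp add: lp_ball_def)
qed

section \<open>ReLU networks\<close>

definition ray_affine_vec :: "nat \<Rightarrow> ('a::real_normed_vector \<Rightarrow> real vec) \<Rightarrow> bool" where
  "ray_affine_vec n g \<longleftrightarrow> (\<forall>x. dim_vec (g x) = n) \<and> (\<forall>i<n. ray_affine (\<lambda>x. g x $ i))"

lemma ray_affine_vec_input: "ray_affine_vec CARD('d) (input_vec :: real ^ 'd \<Rightarrow> real vec)"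
  unfolding ray_affine_vec_def input_vec_def
  by (auto intro: ray_affine_bounded_linear bounded_linear_vec_nth)

lemma ray_affine_vec_mult_mat:
  assumes g: "ray_affine_vec m g" and W: "dim_col W = m"
  shows "ray_affine_vec (dim_row W) (\<lambda>x. W *\<^sub>v g x)"
proof -
  have "(W *\<^sub>v g x) $ i = (\<Sum>j\<in>{0..<m}. W $$ (i, j) * g x $ j)" if "i < dim_row W" for i x
    using that g W by (simp add: ray_affine_vec_def scalar_prod_def)
  moreover have "ray_affine (\<lambda>x. \<Sum>j\<in>{0..<m}. W $$ (i, j) * g x $ j)" for i
    using g by (intro ray_affine_sum ray_affine_cmult) (simp add: ray_affine_vec_def)
  ultimately show ?thesis
    by (simp add: ray_affine_vec_def)
qed

lemma ray_affine_vec_relu: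
  assumes "ray_affine_vec n g"
  shows "ray_affine_vec n (\<lambda>x. map_vec relu (g x))"
  using assms by (simp add: ray_affine_vec_def ray_affine_relu)

text \<open>The first layer acts first, so the induction absorbs it into the input map; hence
  \<open>g\<close> and its width \<open>m\<close> are generalised.\<close>

lemma ray_affine_vec_relu_layers:
  assumes "ray_affine_vec m g" "layer_dims m Ws n"
  shows "ray_affine_vec n (\<lambda>x. relu_layers Ws (g x))"
  using assms
proof (induction Ws arbitrary: m g)
  case (Cons W Ws)
  then have "ray_affine_vec (dim_row W) (\<lambda>x. map_vec relu (W *\<^sub>v g x))"
    by (intro ray_affine_vec_relu ray_affine_vec_mult_mat) auto
  from Cons.IH[OF this] Cons.prems show ?case by simp
qed simp

lemma ray_affine_vec_relu_net:
  assumes "layer_dims CARD('d) Ws n"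
  shows "ray_affine_vec n (relu_net Ws :: real ^ 'd \<Rightarrow> real vec)"
  using ray_affine_vec_relu_layers[OF ray_affine_vec_input assms]
  by (simp add: relu_net_def[abs_def])

text \<open>Splits off the output layer, which sits at the end of the list while
  \<open>layer_dims\<close> recurses from the front.\<close>

lemma layer_dims_append:
  "layer_dims m (Ws @ [W]) n \<longleftrightarrow> layer_dims m Ws (dim_col W) \<and> dim_row W = n"
  by (induction Ws arbitrary: m) auto

lemma relu_function_ray_affine: "is_relu_function l h \<Longrightarrow> ray_affine h"
  using ray_affine_vec_relu_net by (auto simp: is_relu_function_def ray_affine_vec_def)

lemma relu_classifier_ray_affine:
  fixes f :: "real ^ 'd \<Rightarrow> real vec"
  assumes "is_relu_classifier K f"
  shows "ray_affine_vec K f"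
proof -
  obtain Ws where Ws: "Ws \<noteq> []" "layer_dims CARD('d) Ws K"
    "f = relu_net Ws \<or> f = (\<lambda>x. last Ws *\<^sub>v relu_net (butlast Ws) x)"
    using assms by (auto simp: is_relu_classifier_def)
  \<comment> \<open>The hidden layers end in the width that the output matrix expects; with no
    hidden layer this is the input dimension.\<close>
  have "layer_dims CARD('d) (butlast Ws) (dim_col (last Ws))" "dim_row (last Ws) = K"
    using Ws(1,2) layer_dims_append[of _ "butlast Ws" "last Ws"] by auto
  then have "ray_affine_vec K (\<lambda>x :: real ^ 'd. last Ws *\<^sub>v relu_net (butlast Ws) x)"
    using ray_affine_vec_mult_mat[OF ray_affine_vec_relu_net] by blast
  with Ws show ?thesis
    using ray_affine_vec_relu_net by blast
qed

lemma relu_classifier_margin: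
  "is_relu_classifier K f \<Longrightarrow> c < K \<Longrightarrow> j < K \<Longrightarrow> ray_affine (margin f c j)"
  using relu_classifier_ray_affine[of K f]
  by (simp add: margin_def[abs_def] ray_affine_vec_def ray_affine_diff)

section \<open>Robustness guarantees\<close>

text \<open>For \<open>L = 0\<close> the conclusion is \<open>0 \<le> m\<close>, whatever the
  quotient is.\<close>

lemma ereal_le_divide_imp:
  assumes "ereal n \<le> ereal m / ereal L" "0 \<le> L" "0 \<le> m"
  shows "L * n \<le> m"
proof (cases "L = 0")
  case False
  with assms show ?thesis
    by (simp add: pos_le_divide_eq mult.commute)
qed (use assms in simp)

text \<open>For \<open>L = 0\<close> the strict inequality relies on \<open>0 / 0 = 0\<close>.\<close>

lemma ereal_less_divide_imp:
  assumes "ereal n < ereal m / ereal L" "0 \<le> L" "0 \<le> m" "0 \<le> n"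
  shows "L * n < m"
proof (cases "L = 0")
  case True
  \<comment> \<open>If \<open>m = 0\<close>, the bound reads \<open>n < 0\<close>, contradicting
    \<open>0 \<le> n\<close>; otherwise the claim is \<open>0 < m\<close>.\<close>
  with assms show ?thesis
    by (cases "m = 0") (auto simp: zero_ereal_def[symmetric])
next
  case False
  with assms show ?thesis
    by (simp add: pos_less_divide_eq mult.commute)
qed

text \<open>From \<open>x0\<close> to \<open>x0 + \<delta>\<close> the margin drops by at most the
  Lipschitz constant times the norm of \<open>\<delta>\<close>, which the bound compares with the
  initial margin.\<close>

lemma margin_guarantee:
  assumes p: "1 \<le> p" and h: "ray_affine (margin f c j)"
    and S: "closed_segment x0 (x0 + \<delta>) \<subseteq> S" and m: "0 \<le> margin f c j x0"
  shows "ereal (lp_norm p \<delta>) \<le> class_bound p f c x0 S j \<Longrightarrow> 0 \<le> margin f c j (x0 + \<delta>)"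
    and "ereal (lp_norm p \<delta>) < class_bound p f c x0 S j \<Longrightarrow> 0 < margin f c j (x0 + \<delta>)"
proof -
  let ?L = "dir_lip p (margin f c j) S"
  have "x0 \<in> S"
    using S by auto
  then have L: "0 \<le> ?L"
    by (rule dir_lip_nonneg[OF p h])
  have *: "margin f c j x0 - margin f c j (x0 + \<delta>) \<le> ?L * lp_norm p \<delta>"
    using dir_lip_segment_bound[OF p h S] lp_norm_minus[OF p, of \<delta>] by simp
  show "0 \<le> margin f c j (x0 + \<delta>)" if "ereal (lp_norm p \<delta>) \<le> class_bound p f c x0 S j"
    using * ereal_le_divide_imp[OF that[unfolded class_bound_def] L m] by linarith
  show "0 < margin f c j (x0 + \<delta>)" if "ereal (lp_norm p \<delta>) < class_bound p f c x0 S j"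
    using * ereal_less_divide_imp[OF that[unfolded class_bound_def] L m lp_norm_nonneg] by linarith
qed

text \<open>\<open>ties_to\<close> stays outside the locale, since the strict guarantees hold for
  every prediction rule.\<close>

locale relu_classifier_prediction =
  fixes p :: ereal and K :: nat and f :: "real ^ 'd \<Rightarrow> real vec"
    and pred :: "real ^ 'd \<Rightarrow> nat" and x0 :: "real ^ 'd" and c :: nat
  assumes p: "1 \<le> p" and relu: "is_relu_classifier K f"
    and rule: "prediction_rule K f pred" and c: "c = pred x0"
begin

lemma pred_less: "pred x < K"
  and pred_max: "i < K \<Longrightarrow> f x $ i \<le> f x $ pred x"
  using rule by (auto simp: prediction_rule_def is_arg_max_linorder)

lemma ray_affine_margin: "j < K \<Longrightarrow> ray_affine (margin f c j)"
  using relu_classifier_margin[OF relu] pred_less c by blast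

lemma margin_nonneg: "j < K \<Longrightarrow> 0 \<le> margin f c j x0"
  using pred_max c by (simp add: margin_def)

text \<open>If \<open>j\<close> were predicted, the nonnegative margin would make \<open>c\<close> a
  maximiser as well, and the tie rule would then select \<open>c\<close>.\<close>

lemma targeted_le:
  assumes ties: "ties_to c K f pred" and j: "j \<in> {..<K} - {c}"
    and S: "closed_segment x0 (x0 + \<delta>) \<subseteq> S"
    and bound: "ereal (lp_norm p \<delta>) \<le> class_bound p f c x0 S j"
  shows "pred (x0 + \<delta>) \<noteq> j"
proof
  assume pred: "pred (x0 + \<delta>) = j"
  have "0 \<le> margin f c j (x0 + \<delta>)"
    using j by (intro margin_guarantee(1)[OF p _ S _ bound] ray_affine_margin margin_nonneg) auto
  then have "f (x0 + \<delta>) $ i \<le> f (x0 + \<delta>) $ c" if "i < K" for i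
    using pred_max[OF that, of "x0 + \<delta>"] pred by (simp add: margin_def)
  then have "is_arg_max (\<lambda>i. f (x0 + \<delta>) $ i) (\<lambda>i. i < K) c"
    using pred_less c by (simp add: is_arg_max_linorder)
  then show False
    using ties j pred by (auto simp: ties_to_def)
qed

text \<open>A positive margin puts \<open>c\<close> strictly above \<open>j\<close>, so
  \<open>j\<close> attains no maximum, however ties are resolved.\<close>

lemma targeted_less:
  assumes j: "j \<in> {..<K} - {c}"
    and S: "closed_segment x0 (x0 + \<delta>) \<subseteq> S"
    and bound: "ereal (lp_norm p \<delta>) < class_bound p f c x0 S j"
  shows "pred (x0 + \<delta>) \<noteq> j"
proof
  assume pred: "pred (x0 + \<delta>) = j"
  have "0 < margin f c j (x0 + \<delta>)"
    using j by (intro margin_guarantee(2)[OF p _ S _ bound] ray_affine_margin margin_nonneg) auto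
  then show False
    using pred_max[of c "x0 + \<delta>"] pred_less[of x0] c pred by (simp add: margin_def)
qed

text \<open>A prediction other than \<open>c\<close> is itself one of the classes in the minimum, so
  the targeted guarantee for that class refutes it.\<close>

lemma untargeted_le:
  assumes "ties_to c K f pred" and "closed_segment x0 (x0 + \<delta>) \<subseteq> S"
    and "ereal (lp_norm p \<delta>) \<le> min_class_bound p K f c x0 S"
  shows "pred (x0 + \<delta>) = c"
proof (rule ccontr)
  assume "pred (x0 + \<delta>) \<noteq> c"
  then have j: "pred (x0 + \<delta>) \<in> {..<K} - {c}"
    using pred_less by auto
  then have "ereal (lp_norm p \<delta>) \<le> class_bound p f c x0 S (pred (x0 + \<delta>))"
    using assms(3) by (simp add: min_class_bound_def le_INF_iff)
  then show False
    using targeted_le[OF assms(1) j assms(2)] by blast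
qed

lemma untargeted_less:
  assumes "closed_segment x0 (x0 + \<delta>) \<subseteq> S"
    and "ereal (lp_norm p \<delta>) < min_class_bound p K f c x0 S"
  shows "pred (x0 + \<delta>) = c"
proof (rule ccontr)
  assume "pred (x0 + \<delta>) \<noteq> c"
  then have j: "pred (x0 + \<delta>) \<in> {..<K} - {c}"
    using pred_less by auto
  have "ereal (lp_norm p \<delta>) < class_bound p f c x0 S (pred (x0 + \<delta>))"
    by (rule less_INF_D[OF assms(2)[unfolded min_class_bound_def] j])
  then show False
    using targeted_less[OF j assms(1)] by blast
qed

lemma distortion_lower_bound:
  assumes "ties_to c K f pred"
  shows "distortion_lower_bound p pred x0 (min_class_bound p K f c x0 UNIV)"
proof -
  have "\<not> adversarial pred x0 \<delta>"
    if "ereal (lp_norm p \<delta>) \<le> min_class_bound p K f c x0 UNIV" for \<delta>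
    using untargeted_le[OF assms subset_UNIV that] c by (simp add: adversarial_def)
  \<comment> \<open>Adversarial perturbations have norm above the bound, so the bound lies below
    their infimum, which is \<open>\<infinity>\<close> if there are none.\<close>
  moreover from this have "min_class_bound p K f c x0 UNIV \<le> min_distortion p pred x0"
    unfolding min_distortion_def by (intro INF_greatest) (use linear in blast)
  ultimately show ?thesis
    by (simp add: distortion_lower_bound_def)
qed

end

theorem lemma3p3:
  fixes p q :: ereal
  assumes "1 \<le> p" and "1 \<le> q" and "1 / p + 1 / q = 1"
  shows
    "(\<forall>l (h :: real ^ 'd \<Rightarrow> real) S.
        is_relu_function l h \<and> convex S \<and> bounded S \<and> closed S \<longrightarrow>
        (\<forall>x\<in>S. \<forall>y\<in>S. \<bar>h x - h y\<bar> \<le> dir_lip p h S * lp_norm p (x - y)))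
     \<and>
     (\<forall>K (f :: real ^ 'd \<Rightarrow> real vec) pred x0 c.
        is_relu_classifier K f \<and> prediction_rule K f pred \<and> c = pred x0 \<longrightarrow>
        (ties_to c K f pred \<longrightarrow>
           (\<forall>\<delta>. ereal (lp_norm p \<delta>) \<le> min_class_bound p K f c x0 UNIV \<longrightarrow> pred (x0 + \<delta>) = c) \<and>
           distortion_lower_bound p pred x0 (min_class_bound p K f c x0 UNIV) \<and>
           (\<forall>R. \<forall>\<delta>\<in>lp_ball p 0 R.
              ereal (lp_norm p \<delta>) \<le> min (min_class_bound p K f c x0 (lp_ball p x0 R)) (ereal R) \<longrightarrow>
              pred (x0 + \<delta>) = c) \<and>
           (\<forall>R. \<forall>j\<in>{..<K} - {c}. \<forall>\<delta>\<in>lp_ball p 0 R.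
              ereal (lp_norm p \<delta>) \<le> min (class_bound p f c x0 (lp_ball p x0 R) j) (ereal R) \<longrightarrow>
              \<not> successful_targeted pred j x0 \<delta>)) \<and>
        ((\<forall>\<delta>. ereal (lp_norm p \<delta>) < min_class_bound p K f c x0 UNIV \<longrightarrow> pred (x0 + \<delta>) = c) \<and>
           (\<forall>R. \<forall>\<delta>\<in>lp_ball p 0 R.
              ereal (lp_norm p \<delta>) < min_class_bound p K f c x0 (lp_ball p x0 R) \<longrightarrow>
              pred (x0 + \<delta>) = c) \<and>
           (\<forall>R. \<forall>j\<in>{..<K} - {c}. \<forall>\<delta>\<in>lp_ball p 0 R.
              ereal (lp_norm p \<delta>) < class_bound p f c x0 (lp_ball p x0 R) j \<longrightarrow>
              \<not> successful_targeted pred j x0 \<delta>)))"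
proof (intro conjI allI impI)
  fix l and h :: "real ^ 'd \<Rightarrow> real" and S :: "(real ^ 'd) set"
  assume A: "is_relu_function l h \<and> convex S \<and> bounded S \<and> closed S"
  \<comment> \<open>Convexity enters here: it puts the segment between \<open>x\<close> and
    \<open>y\<close> inside \<open>S\<close>.\<close>
  show "\<forall>x\<in>S. \<forall>y\<in>S. \<bar>h x - h y\<bar> \<le> dir_lip p h S * lp_norm p (x - y)"
    using A by (intro ballI dir_lip_segment_bound assms(1) closed_segment_subset)
      (auto intro: relu_function_ray_affine)
next
  fix K c x0 pred and f :: "real ^ 'd \<Rightarrow> real vec"
  assume "is_relu_classifier K f \<and> prediction_rule K f pred \<and> c = pred x0"
  with assms(1) interpret relu_classifier_prediction p K f pred x0 c
    by unfold_locales auto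
  \<comment> \<open>The segment to \<open>x0 + \<delta>\<close> stays in the ball, so the local
    Lipschitz constant governs the margins along it.\<close>
  note ball = closed_segment_lp_ball[OF assms(1)]
  {
    assume ties: "ties_to c K f pred"
    show "pred (x0 + \<delta>) = c" if "ereal (lp_norm p \<delta>) \<le> min_class_bound p K f c x0 UNIV" for \<delta>
      using untargeted_le[OF ties subset_UNIV that] .
    show "distortion_lower_bound p pred x0 (min_class_bound p K f c x0 UNIV)"
      using distortion_lower_bound[OF ties] .
    show "\<forall>\<delta>\<in>lp_ball p 0 R.
        ereal (lp_norm p \<delta>) \<le> min (min_class_bound p K f c x0 (lp_ball p x0 R)) (ereal R) \<longrightarrow>
        pred (x0 + \<delta>) = c" for R
      using untargeted_le[OF ties ball] by auto
    show "\<forall>j\<in>{..<K} - {c}. \<forall>\<delta>\<in>lp_ball p 0 R.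
        ereal (lp_norm p \<delta>) \<le> min (class_bound p f c x0 (lp_ball p x0 R) j) (ereal R) \<longrightarrow>
        \<not> successful_targeted pred j x0 \<delta>" for R
      using targeted_le[OF ties _ ball] by (auto simp: successful_targeted_def)
  }
  show "pred (x0 + \<delta>) = c" if "ereal (lp_norm p \<delta>) < min_class_bound p K f c x0 UNIV" for \<delta>
    using untargeted_less[OF subset_UNIV that] .
  show "\<forall>\<delta>\<in>lp_ball p 0 R.
      ereal (lp_norm p \<delta>) < min_class_bound p K f c x0 (lp_ball p x0 R) \<longrightarrow>
      pred (x0 + \<delta>) = c" for R
    using untargeted_less[OF ball] by blast
  show "\<forall>j\<in>{..<K} - {c}. \<forall>\<delta>\<in>lp_ball p 0 R.
      ereal (lp_norm p \<delta>) < class_bound p f c x0 (lp_ball p x0 R) j \<longrightarrow>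
      \<not> successful_targeted pred j x0 \<delta>" for R
    using targeted_less[OF _ ball] unfolding successful_targeted_def by blast
qed

end
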